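(* Let $f(x)=Ax$ with $x\in\mathbb{R}^N$ and $h(x)=Cx\in\mathbb{R}^M$. Assume that all eigenvalues $\lambda_k$, $k=1,\dots,N$ (counted with multiplicity), of $A$ have absolute value greater than one. If the observer error dynamics of $e_t=x_t-\hat x_t$, for the plant $x_{t+1}=Ax_t$, $y_t=\xi_tCx_t$ and the observer $\hat x_{t+1}=A\hat x_t+\xi_tK(Cx_t)-\xi_tK(C\hat x_t)$, is mean square exponentially (MSE) stable, then $$(1-p)^M\left(\prod_{k=1}^N|\lambda_k|\right)^2<1.$$
   Context: Setting. $A\in\mathbb{R}^{N\times N}$, $C\in\mathbb{R}^{M\times N}$, $M<N$, state space $X=\mathbb{R}^N$. The $\xi_t\in\{0,1\}$, $t\ge 0$, are i.i.d. Bernoulli random variables with $\mathrm{Prob}(\xi_t=1)=p$, $0<p<1$ ($1-p$ is the erasure probability). $E_{\xi_0^t}[\cdot]$ denotes expectation over $\{\xi_0,\dots,\xi_t\}$. Standing assumption (observability): the matrix obtained by stacking $C,CA,\dots,CA^{N-1}$ has rank $N$. Observer gain: $K:\mathbb{R}^M\to\mathbb{R}^N$ is deterministic, is not an explicit function of $\xi_t$ or its history, is $C^r$ with $r\ge1$, and satisfies $K(0)=0$. MSE stability of the error dynamics: there exist positive constants $L<\infty$, $\beta<1$ such that $E_{\xi_0^t}[\|e_{t+1}\|^2]\le L\beta^t\|e_0\|^2$ for all $t\ge0$ and Lebesgue almost all initial conditions ($x_0$ and $e_0$). *)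

theory Defs
  imports "HOL-Probability.Probability" "HOL-Computational_Algebra.Computational_Algebra"
begin

primrec mat_power :: "'a::semiring_1^'n^'n \<Rightarrow> nat \<Rightarrow> 'a^'n^'n" where
  "mat_power A 0 = mat 1"
| "mat_power A (Suc k) = A ** mat_power A k"

(* The blocks C, CA, ..., CA^(N-1) stacked.  The rows are indexed by pairs (i, j): row j of the
   block C A^k, where k = to_nat_on UNIV i runs bijectively through 0, ..., N-1. *)
definition observability_matrix ::
  "real^'n^'n \<Rightarrow> real^'n^'m \<Rightarrow> real^'n^('n \<times> 'm)" where
  "observability_matrix A C =
    (\<chi> ij. (C ** mat_power A (to_nat_on (UNIV :: 'n set) (fst ij))) $ snd ij)"

definition observable :: "real^'n^'n \<Rightarrow> real^'n^'m \<Rightarrow> bool" where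
  "observable A C \<longleftrightarrow> rank (observability_matrix A C) = CARD('n)"

(* det (X I - A) over the complex polynomials *)
definition charpoly :: "real^'n^'n \<Rightarrow> complex poly" where
  "charpoly A =
    det (\<chi> i j. (if i = j then [:0, 1:] else 0) - [:complex_of_real (A $ i $ j):])"

(* proots counts each root with its order, so this is a multiset with algebraic multiplicities. *)
definition eigenvalues :: "real^'n^'n \<Rightarrow> complex multiset" where
  "eigenvalues A = proots (charpoly A)"

(* f is of class C^r on the whole space.  In finite dimensions the derivative is of class C^r as an
   operator-valued map iff all x \<mapsto> Df(x) v are, which keeps the recursion within one type. *)
primrec C_class :: "nat \<Rightarrow> ('a::euclidean_space \<Rightarrow> 'b::euclidean_space) \<Rightarrow> bool" where
  "C_class 0 f \<longleftrightarrow> continuous_on UNIV f"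
| "C_class (Suc r) f \<longleftrightarrow>
    (\<exists>D. (\<forall>x. (f has_derivative D x) (at x)) \<and> (\<forall>v. C_class r (\<lambda>x. D x v)))"

primrec plant_state :: "real^'n^'n \<Rightarrow> real^'n \<Rightarrow> nat \<Rightarrow> real^'n" where
  "plant_state A x0 0 = x0"
| "plant_state A x0 (Suc t) = A *v plant_state A x0 t"

(* s is a realisation of the erasure process.  For s t in {0, 1} and K 0 = 0, the injected term
   s t K(C x_t) equals K(y_t) for the received output y_t = s t C x_t, so the observer depends on
   the plant only through y. *)
primrec observer_state ::
  "real^'n^'n \<Rightarrow> real^'n^'m \<Rightarrow> (real^'m \<Rightarrow> real^'n) \<Rightarrow> (nat \<Rightarrow> real)
    \<Rightarrow> real^'n \<Rightarrow> real^'n \<Rightarrow> nat \<Rightarrow> real^'n" where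
  "observer_state A C K s x0 xhat0 0 = xhat0"
| "observer_state A C K s x0 xhat0 (Suc t) =
    A *v observer_state A C K s x0 xhat0 t
      + s t *\<^sub>R K (C *v plant_state A x0 t)
      - s t *\<^sub>R K (C *v observer_state A C K s x0 xhat0 t)"

(* Parametrised by (x_0, e_0), hence the observer starts at x_0 - e_0. *)
definition observer_error ::
  "real^'n^'n \<Rightarrow> real^'n^'m \<Rightarrow> (real^'m \<Rightarrow> real^'n) \<Rightarrow> (nat \<Rightarrow> real)
    \<Rightarrow> real^'n \<Rightarrow> real^'n \<Rightarrow> nat \<Rightarrow> real^'n" where
  "observer_error A C K s x0 e0 t =
    plant_state A x0 t - observer_state A C K s x0 (x0 - e0) t"

(* The error at time t + 1 depends on xi 0, ..., xi t only, so the expectation over the whole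
   probability space W is the expectation over these variables. *)
definition MSE_stable ::
  "'w measure \<Rightarrow> (nat \<Rightarrow> 'w \<Rightarrow> real)
    \<Rightarrow> real^'n^'n \<Rightarrow> real^'n^'m \<Rightarrow> (real^'m \<Rightarrow> real^'n) \<Rightarrow> bool" where
  "MSE_stable W \<xi> A C K \<longleftrightarrow>
    (\<exists>L \<beta>. 0 < L \<and> 0 < \<beta> \<and> \<beta> < 1 \<and>
      (AE (x0, e0) in lebesgue. \<forall>t.
        integral\<^sup>L W (\<lambda>\<omega>. (norm (observer_error A C K (\<lambda>k. \<xi> k \<omega>) x0 e0 (Suc t)))\<^sup>2)
          \<le> L * \<beta> ^ t * (norm e0)\<^sup>2))"

definition iid_bernoulli :: "'w measure \<Rightarrow> (nat \<Rightarrow> 'w \<Rightarrow> real) \<Rightarrow> real \<Rightarrow> bool" where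
  "iid_bernoulli W \<xi> p \<longleftrightarrow>
    prob_space W \<and>
    prob_space.indep_vars W (\<lambda>_. borel) \<xi> UNIV \<and>
    (\<forall>t. \<forall>\<omega>\<in>space W. \<xi> t \<omega> \<in> {0, 1}) \<and>
    (\<forall>t. measure W {\<omega> \<in> space W. \<xi> t \<omega> = 1} = p)"

end

theory Submission
  imports Defs
begin

text \<open>
Stability forces a second-moment matrix to tend to zero, while each step multiplies its determinant
by at least $(1-p)^M \det(A)^2$; so this factor is less than one.

First, the problem is linear. For each \<open>t\<close>, the mean square error is a finite sum over the
erasure patterns of the first \<open>t\<close> steps, hence continuous in the initial data, so the stability
bound passes from almost all to all initial data. In particular it holds for \<open>x\<^sub>0 = 0\<close>
and \<open>e\<^sub>0 = \<epsilon> v\<close>; dividing by \<open>\<epsilon>\<^sup>2\<close> and letting \<open>\<epsilon>\<close> tend to \<open>0\<close> gives the same bound for the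
linear system whose step is \<open>F = A - B C\<close> when the packet arrives and \<open>A\<close> when it is lost, where
\<open>B\<close> is the derivative of \<open>K\<close> at \<open>0\<close> (\<open>MSE_stable_imp_linearisation_stable\<close>).

Let \<open>\<Phi>\<^sub>t\<close> be the random transition matrix of this linear system and \<open>S\<^sub>t\<close> the mean of
\<open>\<Phi>\<^sub>t \<Phi>\<^sub>t\<^sup>T\<close>. Independence gives \<open>S\<^sub>t\<^sub>+\<^sub>1 = (1 - p) A S\<^sub>t A\<^sup>T + p F S\<^sub>t F\<^sup>T\<close>. Now \<open>A\<close> and \<open>F\<close> agree
on the kernel of \<open>C\<close>, whose codimension is at most \<open>M\<close>. Hence, with \<open>S\<^sub>t = R R\<^sup>T\<close>, there is an
orthonormal basis in which \<open>A R\<close> and \<open>F R\<close> differ in at most \<open>M\<close> directions; dropping the arrival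
term in just these directions leaves a determinant of at least $(1-p)^M \det(A)^2 \det S_t$, and
restoring it adds a positive semidefinite matrix, which cannot lower the determinant. Therefore
$\det S_{t+1} \geq (1-p)^M \det(A)^2 \det S_t$ (\<open>ex_gram_of_mixture\<close>).

On the other hand the trace of \<open>S\<^sub>t\<close> is a sum of mean square errors of the linear system, so it tends to
\<open>0\<close>, and so does its determinant. The factor $(1-p)^M \det(A)^2$ must then be less than
one (\<open>mean_square_stable_imp_det_bound\<close>), and $|\det A|$ is the product of the moduli of the eigenvalues.
\<close>

section \<open>Gram matrices and the determinant of a mixture\<close>

definition outer :: "real^'n \<Rightarrow> real^'n^'n" where
  "outer w = (\<chi> i j. w $ i * w $ j)"

definition diag :: "('n \<Rightarrow> real) \<Rightarrow> real^'n^'n" where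
  "diag d = (\<chi> i j. if i = j then d i else 0)"

lemma det_diag: "det (diag d) = (\<Prod>i\<in>UNIV. d i)"
  by (subst det_diagonal) (auto simp: diag_def)

lemma column_mult_diag: "column i (U ** diag d) = d i *\<^sub>R column i U"
  by (simp add: column_def diag_def matrix_matrix_mult_def vec_eq_iff if_distrib
      sum.delta cong: if_cong)

lemma column_matrix_mult: "column i (U ** Q) = U *v column i Q"
  by (simp add: column_def matrix_matrix_mult_def matrix_vector_mult_def vec_eq_iff)

lemma outer_scaleR: "outer (c *\<^sub>R w) = c\<^sup>2 *\<^sub>R outer w"
  by (simp add: outer_def vec_eq_iff power2_eq_square)

lemma gram_eq_sum_outer: "U ** transpose U = (\<Sum>i\<in>UNIV. outer (column i U))"
  for U :: "real^'n^'n"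
  by (simp add: outer_def column_def transpose_def matrix_matrix_mult_def vec_eq_iff)

lemma gram_mult_diag:
  fixes U :: "real^'n^'n"
  shows "(U ** diag d) ** transpose (U ** diag d) = (\<Sum>i\<in>UNIV. (d i)\<^sup>2 *\<^sub>R outer (column i U))"
  unfolding gram_eq_sum_outer column_mult_diag outer_scaleR ..

lemma gram_orthogonal:
  fixes U Q :: "real^'n^'n"
  assumes "orthogonal_matrix Q"
  shows "(U ** Q) ** transpose (U ** Q) = U ** transpose U"
proof -
  have "(U ** Q) ** transpose (U ** Q) = U ** (Q ** transpose Q) ** transpose U"
    by (simp add: matrix_transpose_mul matrix_mul_assoc)
  then show ?thesis
    using assms by (simp add: orthogonal_matrix_def)
qed

lemma gram_eq_sum_outer_orthogonal:
  fixes U Q :: "real^'n^'n"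
  assumes "orthogonal_matrix Q"
  shows "U ** transpose U = (\<Sum>i\<in>UNIV. outer (U *v column i Q))"
  using gram_eq_sum_outer[of "U ** Q"] gram_orthogonal[OF assms, of U]
  by (simp add: column_matrix_mult)

lemma det_orthogonal_matrix_squared:
  fixes Q :: "real^'n^'n"
  assumes "orthogonal_matrix Q"
  shows "(det Q)\<^sup>2 = 1"
  using det_orthogonal_matrix[OF assms] by auto

text \<open>The case of rank one in the monotonicity of the determinant on positive definite matrices. After
factoring out \<open>R\<close>, the perturbed matrix is the identity plus \<open>u u\<^sup>T\<close>; rotating an axis onto \<open>u\<close>
makes it diagonal with determinant \<open>1 + |u|\<^sup>2\<close>. Carrying the factor \<open>R'\<close> along, rather than the
matrix itself, lets the step be iterated and keeps positivity implicit.\<close>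

lemma ex_gram_plus_outer:
  fixes R :: "real^'n^'n"
  assumes "det R \<noteq> 0"
  shows "\<exists>R'. R' ** transpose R' = R ** transpose R + outer w \<and> (det R)\<^sup>2 \<le> (det R')\<^sup>2"
proof (cases "w = 0")
  case True
  then show ?thesis by (intro exI[of _ R]) (simp add: outer_def vec_eq_iff)
next
  case False
  obtain R1 where R1: "R ** R1 = mat 1"
    using assms invertible_det_nz[of R] unfolding invertible_def by auto
  define u where "u = R1 *v w"
  have Ru: "R *v u = w"
    by (simp add: u_def matrix_vector_mul_assoc R1)
  with False have "u \<noteq> 0" by auto
  then have "norm (u /\<^sub>R norm u) = 1" by simp
  then obtain P and k :: 'n where P: "orthogonal_matrix P" "P *v axis k 1 = u /\<^sub>R norm u"
    using orthogonal_matrix_exists_basis by blast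
  then have Pk: "column k P = u /\<^sub>R norm u"
    by (simp add: matrix_vector_mult_basis)
  define d where "d = (\<lambda>i. if i = k then sqrt (1 + (norm u)\<^sup>2) else 1)"
  define R' where "R' = R ** P ** diag d"
  have d2: "(d i)\<^sup>2 = 1 + (if i = k then (norm u)\<^sup>2 else 0)" for i
    by (simp add: d_def add_nonneg_nonneg)
  have "R' ** transpose R' = (\<Sum>i\<in>UNIV. (d i)\<^sup>2 *\<^sub>R outer (R *v column i P))"
    unfolding R'_def
    by (simp add: gram_mult_diag column_matrix_mult matrix_vector_mul_assoc)
  also have "\<dots> = (\<Sum>i\<in>UNIV. outer (R *v column i P)) + (norm u)\<^sup>2 *\<^sub>R outer (R *v column k P)"
    unfolding d2 by (simp add: scaleR_left_distrib sum.distrib if_distrib[of "\<lambda>c. c *\<^sub>R _"] cong: if_cong)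
  also have "(norm u)\<^sup>2 *\<^sub>R outer (R *v column k P) = outer (norm u *\<^sub>R (R *v column k P))"
    by (simp add: outer_scaleR)
  also have "norm u *\<^sub>R (R *v column k P) = w"
    using \<open>u \<noteq> 0\<close> by (simp add: Pk matrix_vector_mult_scaleR Ru)
  also have "(\<Sum>i\<in>UNIV. outer (R *v column i P)) = R ** transpose R"
    by (rule gram_eq_sum_outer_orthogonal[OF P(1), symmetric])
  finally have 1: "R' ** transpose R' = R ** transpose R + outer w" .
  have "(det R')\<^sup>2 = (det R)\<^sup>2 * (\<Prod>i\<in>UNIV. (d i)\<^sup>2)"
    by (simp add: R'_def det_mul det_diag power_mult_distrib prod_power_distrib
        det_orthogonal_matrix_squared[OF P(1)])
  also have "(\<Prod>i\<in>UNIV. (d i)\<^sup>2) \<ge> 1"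
    by (rule prod_ge_1) (simp add: d2)
  hence "(det R)\<^sup>2 * (\<Prod>i\<in>UNIV. (d i)\<^sup>2) \<ge> (det R)\<^sup>2 * 1"
    by (intro mult_left_mono) auto
  finally show ?thesis using 1 by auto
qed

lemma ex_gram_plus_sum_outer:
  fixes R :: "real^'n^'n"
  assumes "det R \<noteq> 0" "finite I"
  shows "\<exists>R'. R' ** transpose R' = R ** transpose R + (\<Sum>i\<in>I. outer (f i)) \<and> (det R)\<^sup>2 \<le> (det R')\<^sup>2"
  using assms(2)
proof (induction I rule: finite_induct)
  case empty
  then show ?case by auto
next
  case (insert i I)
  then obtain R' where R': "R' ** transpose R' = R ** transpose R + (\<Sum>i\<in>I. outer (f i))"
    "(det R)\<^sup>2 \<le> (det R')\<^sup>2" by auto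
  moreover have "0 < (det R)\<^sup>2" using assms by simp
  ultimately have "det R' \<noteq> 0" by auto
  from ex_gram_plus_outer[OF this, of "f i"] obtain R'' where
    "R'' ** transpose R'' = R' ** transpose R' + outer (f i)" "(det R')\<^sup>2 \<le> (det R'')\<^sup>2" by auto
  with R' insert.hyps show ?case
    by (intro exI[of _ R'']) (auto simp: algebra_simps)
qed

text \<open>Juxtaposing orthonormal bases of the span of \<open>V\<close> and of its orthogonal complement. The columns
indexed by \<open>J\<close> are those from the span.\<close>

lemma orthogonal_matrix_adapted_to_span:
  fixes V :: "(real^'n) set"
  obtains Q :: "real^'n^'n" and J :: "'n set" where "orthogonal_matrix Q" "card J = dim V"
    "\<And>v i. v \<in> V \<Longrightarrow> i \<notin> J \<Longrightarrow> orthogonal v (column i Q)"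
proof -
  let ?S = "span V" and ?T = "{y \<in> UNIV. \<forall>x\<in>span V. orthogonal x y}"
  have subT: "subspace ?T"
    by (auto simp: subspace_def orthogonal_clauses)
  obtain B where B: "B \<subseteq> ?S" "pairwise orthogonal B" "\<And>x. x \<in> B \<Longrightarrow> norm x = 1"
      "independent B" "card B = dim ?S"
    by (rule orthonormal_basis_subspace[OF subspace_span[of V]]) blast
  obtain B' where B': "B' \<subseteq> ?T" "pairwise orthogonal B'" "\<And>x. x \<in> B' \<Longrightarrow> norm x = 1"
      "independent B'" "card B' = dim ?T"
    by (rule orthonormal_basis_subspace[OF subT]) blast
  have fin: "finite B" "finite B'"
    using B(4) B'(4) independent_imp_finite by auto
  have orth: "orthogonal x y" if "x \<in> B" "y \<in> B'" for x y
    using that B(1) B'(1) by blast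
  have "B \<inter> B' = {}"
  proof (rule ccontr)
    assume "B \<inter> B' \<noteq> {}"
    then obtain x where "x \<in> B" "x \<in> B'" by auto
    with orth[of x x] B(3)[of x] show False by (auto simp: orthogonal_def)
  qed
  moreover have "dim ?T + dim ?S = CARD('n)"
    using dim_subspace_orthogonal_to_vectors[OF subspace_span[of V] subspace_UNIV] by simp
  ultimately have "card (B \<union> B') = CARD('n)"
    using fin B(5) B'(5) by (simp add: card_Un_disjoint)
  then obtain f where f: "bij_betw f (UNIV :: 'n set) (B \<union> B')"
    using fin finite_same_card_bij[of "UNIV :: 'n set" "B \<union> B'"] by auto
  have fn: "norm (f i) = 1" for i
    using bij_betwE[OF f] B(3) B'(3) by blast
  have fo: "orthogonal (f i) (f j)" if "i \<noteq> j" for i j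
  proof -
    have "f i \<noteq> f j" "f i \<in> B \<union> B'" "f j \<in> B \<union> B'"
      using f that by (auto simp: bij_betw_def inj_on_def)
    then show ?thesis
      using B(2) B'(2) orth[of "f i" "f j"] orth[of "f j" "f i"]
      by (auto simp: pairwise_def orthogonal_commute)
  qed
  define Q :: "real^'n^'n" where "Q = (\<chi> i j. f j $ i)"
  have col: "column i Q = f i" for i
    by (simp add: Q_def column_def)
  define J where "J = {i. f i \<in> B}"
  show thesis
  proof (rule that[of Q J])
    show "orthogonal_matrix Q"
      by (simp add: orthogonal_matrix_orthonormal_columns col fn fo)
    have "f ` J = B"
      using f by (auto simp: J_def bij_betw_def)
    moreover have "inj_on f J"
      using f by (auto simp: bij_betw_def inj_on_def)
    ultimately show "card J = dim V"
      using B(5) card_image by fastforce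
    show "orthogonal v (column i Q)" if "v \<in> V" "i \<notin> J" for v i
    proof -
      have "f i \<in> B'" using that bij_betwE[OF f] by (auto simp: J_def)
      then show ?thesis using B'(1) that by (auto simp: col span_base)
    qed
  qed
qed

text \<open>The determinant inequality behind the theorem. Take an orthonormal basis adapted to the row space
of \<open>C R\<close>, with \<open>J\<close> indexing the at most \<open>M\<close> vectors inside it. On the other basis vectors \<open>C R\<close>
vanishes, so there \<open>A R\<close> and \<open>F R\<close> coincide and the weights \<open>1 - p\<close> and \<open>p\<close> add up to one.
Discarding the terms of \<open>F R\<close> along \<open>J\<close> leaves the Gram matrix of \<open>A R\<close> with \<open>card J\<close> directions
scaled by \<open>1 - p\<close>; the discarded terms are of rank one and positive.\<close>

lemma ex_gram_of_mixture:
  fixes A F R :: "real^'n^'n" and B :: "real^'m^'n" and C :: "real^'n^'m"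
  assumes "det A \<noteq> 0" "det R \<noteq> 0" "0 \<le> p" "p < 1"
    and F: "F = A - B ** C"
  shows "\<exists>R'. R' ** transpose R' =
      (1 - p) *\<^sub>R ((A ** R) ** transpose (A ** R)) + p *\<^sub>R ((F ** R) ** transpose (F ** R))
    \<and> (1 - p) ^ CARD('m) * (det A)\<^sup>2 * (det R)\<^sup>2 \<le> (det R')\<^sup>2"
proof -
  define U where "U = A ** R"
  define V where "V = F ** R"
  obtain Q :: "real^'n^'n" and J :: "'n set" where Q: "orthogonal_matrix Q"
    and J: "card J = dim (rows (C ** R))"
    and orth: "\<And>v i. v \<in> rows (C ** R) \<Longrightarrow> i \<notin> J \<Longrightarrow> orthogonal v (column i Q)"
    by (rule orthogonal_matrix_adapted_to_span[of "rows (C ** R)"]) blast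
  have "card J \<le> card (rows (C ** R))"
    unfolding J by (intro dim_le_card span_superset) (simp add: rows_def full_SetCompr_eq)
  also have "\<dots> \<le> CARD('m)"
    by (simp add: rows_def full_SetCompr_eq card_image_le)
  finally have cardJ: "card J \<le> CARD('m)" .
  have eq: "V *v column i Q = U *v column i Q" if "i \<notin> J" for i
  proof -
    have "(C ** R) *v column i Q = 0"
      using orth[OF _ that] by (auto simp: vec_eq_iff matrix_vector_mul_component rows_def row_def orthogonal_def)
    then have "C *v (R *v column i Q) = 0"
      by (simp add: matrix_vector_mul_assoc)
    then show ?thesis
      by (simp add: U_def V_def F matrix_vector_mul_assoc[symmetric] matrix_vector_mult_diff_rdistrib)
  qed
  define d where "d = (\<lambda>i. if i \<in> J then sqrt (1 - p) else 1)"
  have d2: "(d i)\<^sup>2 = (if i \<in> J then 1 - p else 1)" for i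
    using assms by (simp add: d_def)
  \<comment> \<open>The factor of the mixture without the arrival terms along \<open>J\<close>.\<close>
  define R0 where "R0 = U ** Q ** diag d"
  have R0: "R0 ** transpose R0 = (\<Sum>i\<in>UNIV. (d i)\<^sup>2 *\<^sub>R outer (U *v column i Q))"
    unfolding R0_def
    by (simp add: gram_mult_diag column_matrix_mult matrix_vector_mul_assoc)
  have "(det R0)\<^sup>2 = (det U)\<^sup>2 * (\<Prod>i\<in>UNIV. (d i)\<^sup>2)"
    by (simp add: R0_def det_mul det_diag power_mult_distrib prod_power_distrib
        det_orthogonal_matrix_squared[OF Q])
  also have "(\<Prod>i\<in>UNIV. (d i)\<^sup>2) = (1 - p) ^ card J"
    by (simp add: d2 prod.If_cases)
  finally have detR0: "(det R0)\<^sup>2 = (1 - p) ^ card J * (det A)\<^sup>2 * (det R)\<^sup>2"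
    by (simp add: U_def det_mul power_mult_distrib)
  have "det R0 \<noteq> 0"
    using detR0 assms by (metis diff_gt_0_iff_gt mult_eq_0_iff power_not_zero less_irrefl zero_eq_power2)
  from ex_gram_plus_sum_outer[OF this, of J "\<lambda>i. sqrt p *\<^sub>R (V *v column i Q)"]
  obtain R' where R': "R' ** transpose R' = R0 ** transpose R0
        + (\<Sum>i\<in>J. outer (sqrt p *\<^sub>R (V *v column i Q)))" "(det R0)\<^sup>2 \<le> (det R')\<^sup>2"
    by auto
  have "(\<Sum>i\<in>J. outer (sqrt p *\<^sub>R (V *v column i Q)))
      = (\<Sum>i\<in>UNIV. if i \<in> J then p *\<^sub>R outer (V *v column i Q) else 0)"
    using assms by (simp add: sum.If_cases outer_scaleR)
  then have "R' ** transpose R' = (\<Sum>i\<in>UNIV. (1 - p) *\<^sub>R outer (U *v column i Q)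
        + p *\<^sub>R outer (V *v column i Q))"
    unfolding R'(1) R0
    by (auto simp: sum.distrib[symmetric] d2 eq scaleR_left_distrib[symmetric] intro!: sum.cong)
  also have "\<dots> = (1 - p) *\<^sub>R (U ** transpose U) + p *\<^sub>R (V ** transpose V)"
    by (simp add: gram_eq_sum_outer_orthogonal[OF Q, of U] gram_eq_sum_outer_orthogonal[OF Q, of V]
        sum.distrib scaleR_sum_right)
  finally have "R' ** transpose R' = (1 - p) *\<^sub>R (U ** transpose U) + p *\<^sub>R (V ** transpose V)" .
  moreover have "(1 - p) ^ CARD('m) * (det A)\<^sup>2 * (det R)\<^sup>2 \<le> (det R')\<^sup>2"
  proof -
    have "(1 - p) ^ CARD('m) \<le> (1 - p) ^ card J"
      using cardJ assms by (intro power_decreasing) auto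
    then have "(1 - p) ^ CARD('m) * ((det A)\<^sup>2 * (det R)\<^sup>2) \<le> (1 - p) ^ card J * ((det A)\<^sup>2 * (det R)\<^sup>2)"
      by (intro mult_right_mono) auto
    with detR0 R'(2) show ?thesis by (simp add: mult.assoc)
  qed
  ultimately show ?thesis
    unfolding U_def V_def by auto
qed

section \<open>Second moments of a linear system with random losses\<close>

definition bernoulli_weight :: "real \<Rightarrow> nat \<Rightarrow> nat set \<Rightarrow> real" where
  "bernoulli_weight p t b = (\<Prod>k<t. if k \<in> b then p else 1 - p)"

text \<open>The mean over the erasure patterns of the first \<open>t\<close> steps; a pattern is the set \<open>b\<close> of times at
which the packet arrives. The values may be vectors or matrices, so that moment matrices are means too.\<close>

definition bernoulli_mean :: "real \<Rightarrow> nat \<Rightarrow> (nat set \<Rightarrow> 'a::real_vector) \<Rightarrow> 'a" where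
  "bernoulli_mean p t g = (\<Sum>b\<in>Pow {..<t}. bernoulli_weight p t b *\<^sub>R g b)"

lemma bernoulli_mean_cong:
  assumes "\<And>b. b \<subseteq> {..<t} \<Longrightarrow> g b = h b"
  shows "bernoulli_mean p t g = bernoulli_mean p t h"
  unfolding bernoulli_mean_def using assms by (intro sum.cong) auto

lemma bernoulli_mean_linear:
  assumes "linear f"
  shows "f (bernoulli_mean p t g) = bernoulli_mean p t (\<lambda>b. f (g b))"
  unfolding bernoulli_mean_def by (simp add: linear_sum[OF assms] linear_cmul[OF assms])

lemma bernoulli_mean_sum:
  "bernoulli_mean p t (\<lambda>b. \<Sum>i\<in>I. g i b) = (\<Sum>i\<in>I. bernoulli_mean p t (g i))"
  unfolding bernoulli_mean_def scaleR_sum_right by (rule sum.swap)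

text \<open>Conditioning on whether the packet arrives at time \<open>t\<close>.\<close>

lemma bernoulli_mean_Suc:
  "bernoulli_mean p (Suc t) g
    = (1 - p) *\<^sub>R bernoulli_mean p t g + p *\<^sub>R bernoulli_mean p t (\<lambda>b. g (insert t b))"
proof -
  have inj: "inj_on (insert t) (Pow {..<t})"
  proof (rule inj_onI)
    fix x y assume "x \<in> Pow {..<t}" "y \<in> Pow {..<t}" and e: "insert t x = insert t y"
    then have "t \<notin> x" "t \<notin> y" by auto
    with e show "x = y" by (metis insert_ident)
  qed
  have Pow_Suc: "Pow {..<Suc t} = Pow {..<t} \<union> insert t ` Pow {..<t}"
    by (simp add: lessThan_Suc Pow_insert)
  have w0: "bernoulli_weight p (Suc t) b = (1 - p) * bernoulli_weight p t b"
    if "b \<subseteq> {..<t}" for b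
    using that by (auto simp: bernoulli_weight_def)
  have w1: "bernoulli_weight p (Suc t) (insert t b) = p * bernoulli_weight p t b" for b
    by (auto simp: bernoulli_weight_def intro!: arg_cong[of _ _ "(*) p"] prod.cong)
  have "bernoulli_mean p (Suc t) g =
      (\<Sum>b\<in>Pow {..<t}. bernoulli_weight p (Suc t) b *\<^sub>R g b)
      + (\<Sum>b\<in>Pow {..<t}. bernoulli_weight p (Suc t) (insert t b) *\<^sub>R g (insert t b))"
    unfolding bernoulli_mean_def Pow_Suc
    by (subst sum.union_disjoint) (auto simp: sum.reindex[OF inj])
  then show ?thesis
    by (simp add: bernoulli_mean_def scaleR_sum_right w0 w1)
qed

text \<open>The event that a given pattern \<open>b\<close> occurs during the first \<open>t\<close> steps has probability
\<open>bernoulli_weight p t b\<close> by independence, and these events partition the sample space. From here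
on, expectations are finite sums, so that integrability, continuity and the interchange with
limits are immediate.\<close>

lemma expectation_eq_bernoulli_mean:
  fixes g :: "nat set \<Rightarrow> real"
  assumes "iid_bernoulli W \<xi> p"
  shows "integral\<^sup>L W (\<lambda>\<omega>. g {k. k < t \<and> \<xi> k \<omega> = 1}) = bernoulli_mean p t g"
proof -
  from assms interpret prob_space W by (simp add: iid_bernoulli_def)
  have ind: "indep_vars (\<lambda>_. borel) \<xi> UNIV"
    and val: "\<And>k \<omega>. \<omega> \<in> space W \<Longrightarrow> \<xi> k \<omega> = 0 \<or> \<xi> k \<omega> = 1"
    and p: "\<And>k. prob {\<omega> \<in> space W. \<xi> k \<omega> = 1} = p"
    using assms by (auto simp: iid_bernoulli_def)
  have meas [measurable]: "\<xi> k \<in> borel_measurable W" for k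
    using ind by (simp add: indep_vars_def)
  have p0: "prob {\<omega> \<in> space W. \<xi> k \<omega> = 0} = 1 - p" for k
  proof -
    have "{\<omega> \<in> space W. \<xi> k \<omega> = 0} = space W - {\<omega> \<in> space W. \<xi> k \<omega> = 1}"
      using val by force
    then show ?thesis by (simp add: prob_compl p)
  qed
  define E where "E b = {\<omega> \<in> space W. \<forall>k<t. \<xi> k \<omega> = (if k \<in> b then 1 else 0)}" for b
  have E_meas [measurable]: "E b \<in> sets W" for b
    unfolding E_def by measurable
  have prob_E: "prob (E b) = bernoulli_weight p t b" for b
  proof (cases "t = 0")
    case True
    then show ?thesis by (simp add: E_def bernoulli_weight_def prob_space)
  next
    case False
    let ?A = "\<lambda>k. {if k \<in> b then 1 else 0 :: real}"
    have "E b = (\<Inter>k\<in>{..<t}. \<xi> k -` ?A k \<inter> space W)"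
      using False by (auto simp: E_def)
    then have "prob (E b) = (\<Prod>k<t. prob (\<xi> k -` ?A k \<inter> space W))"
      using indep_varsD[OF ind, of "{..<t}" ?A] False by auto
    also have "\<dots> = (\<Prod>k<t. if k \<in> b then p else 1 - p)"
      using p p0 by (intro prod.cong) (simp_all add: vimage_def Int_def conj_commute)
    finally show ?thesis by (simp add: bernoulli_weight_def)
  qed
  have "integral\<^sup>L W (\<lambda>\<omega>. g {k. k < t \<and> \<xi> k \<omega> = 1})
      = integral\<^sup>L W (\<lambda>\<omega>. \<Sum>b\<in>Pow {..<t}. g b * indicator (E b) \<omega>)"
  proof (rule Bochner_Integration.integral_cong[OF refl])
    fix \<omega> assume \<omega>: "\<omega> \<in> space W"
    have iff: "\<omega> \<in> E b \<longleftrightarrow> {k. k < t \<and> \<xi> k \<omega> = 1} = b" if "b \<subseteq> {..<t}" for b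
      using that \<omega> val[OF \<omega>] by (auto simp: E_def)
    then have "(\<Sum>b\<in>Pow {..<t}. g b * indicator (E b) \<omega>)
      = (\<Sum>b\<in>Pow {..<t}. if b = {k. k < t \<and> \<xi> k \<omega> = 1} then g b else 0)"
      by (intro sum.cong) (auto simp: indicator_def)
    also have "\<dots> = g {k. k < t \<and> \<xi> k \<omega> = 1}"
      by (subst sum.delta) auto
    finally show "g {k. k < t \<and> \<xi> k \<omega> = 1} = (\<Sum>b\<in>Pow {..<t}. g b * indicator (E b) \<omega>)" ..
  qed
  also have "\<dots> = (\<Sum>b\<in>Pow {..<t}. g b * prob (E b))"
    by (subst Bochner_Integration.integral_sum) (auto simp: emeasure_eq_measure)
  finally show ?thesis
    by (simp add: prob_E bernoulli_mean_def mult.commute)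
qed

primrec transition :: "real^'n^'n \<Rightarrow> real^'n^'n \<Rightarrow> nat set \<Rightarrow> nat \<Rightarrow> real^'n^'n" where
  "transition A F b 0 = mat 1"
| "transition A F b (Suc t) = (if t \<in> b then F else A) ** transition A F b t"

lemma transition_cong:
  "(\<And>k. k < t \<Longrightarrow> k \<in> b \<longleftrightarrow> k \<in> b') \<Longrightarrow> transition A F b t = transition A F b' t"
  by (induction t) auto

definition second_moment :: "real \<Rightarrow> real^'n^'n \<Rightarrow> real^'n^'n \<Rightarrow> nat \<Rightarrow> real^'n^'n" where
  "second_moment p A F t =
    bernoulli_mean p t (\<lambda>b. transition A F b t ** transpose (transition A F b t))"

lemma linear_conjugate: "linear (\<lambda>M. A ** M ** transpose A)" for A :: "real^'n^'n"
  by (rule linearI)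
    (simp_all add: vec_eq_iff matrix_matrix_mult_def algebra_simps sum.distrib sum_distrib_left)

lemma gram_mult: "(A ** R) ** transpose (A ** R) = A ** (R ** transpose R) ** transpose A"
  for A R :: "real^'n^'n"
  by (simp add: matrix_transpose_mul matrix_mul_assoc)

lemma second_moment_Suc:
  "second_moment p A F (Suc t) = (1 - p) *\<^sub>R (A ** second_moment p A F t ** transpose A)
     + p *\<^sub>R (F ** second_moment p A F t ** transpose F)"
proof -
  have "bernoulli_mean p t (\<lambda>b. transition A F b (Suc t) ** transpose (transition A F b (Suc t)))
      = bernoulli_mean p t (\<lambda>b. A ** (transition A F b t ** transpose (transition A F b t)) ** transpose A)"
    by (rule bernoulli_mean_cong) (auto simp: gram_mult)
  moreover have "bernoulli_mean p t (\<lambda>b. transition A F (insert t b) (Suc t)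
        ** transpose (transition A F (insert t b) (Suc t)))
      = bernoulli_mean p t (\<lambda>b. F ** (transition A F b t ** transpose (transition A F b t)) ** transpose F)"
  proof (rule bernoulli_mean_cong)
    fix b
    have "transition A F (insert t b) t = transition A F b t"
      by (rule transition_cong) auto
    then show "transition A F (insert t b) (Suc t) ** transpose (transition A F (insert t b) (Suc t))
      = F ** (transition A F b t ** transpose (transition A F b t)) ** transpose F"
      by (simp add: gram_mult)
  qed
  ultimately show ?thesis
    unfolding second_moment_def bernoulli_mean_Suc
    by (simp add: bernoulli_mean_linear[OF linear_conjugate])
qed

text \<open>Iterating \<open>ex_gram_of_mixture\<close>, starting from the identity matrix.\<close>

lemma ex_gram_second_moment:
  fixes A F :: "real^'n^'n" and B :: "real^'m^'n" and C :: "real^'n^'m"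
  assumes "det A \<noteq> 0" "0 \<le> p" "p < 1" "F = A - B ** C"
  shows "\<exists>R. R ** transpose R = second_moment p A F t
    \<and> ((1 - p) ^ CARD('m) * (det A)\<^sup>2) ^ t \<le> (det R)\<^sup>2"
proof (induction t)
  case 0
  show ?case
    by (intro exI[of _ "mat 1"])
      (simp add: second_moment_def bernoulli_mean_def bernoulli_weight_def)
next
  case (Suc t)
  let ?q = "(1 - p) ^ CARD('m) * (det A)\<^sup>2"
  have q: "0 < ?q" using assms by simp
  from Suc obtain R where R: "R ** transpose R = second_moment p A F t" "?q ^ t \<le> (det R)\<^sup>2"
    by auto
  have "0 < (det R)\<^sup>2"
    using R(2) zero_less_power[OF q, of t] by linarith
  then have "det R \<noteq> 0" by auto
  from ex_gram_of_mixture[OF assms(1) this assms(2-4)] obtain R' where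
    R': "R' ** transpose R' = second_moment p A F (Suc t)"
      "?q * (det R)\<^sup>2 \<le> (det R')\<^sup>2"
    unfolding gram_mult R(1) second_moment_Suc by auto
  have "?q ^ Suc t \<le> ?q * (det R)\<^sup>2"
    using mult_left_mono[OF R(2), of ?q] q by simp
  with R' show ?case by (meson order.trans)
qed

lemma norm_matrix_squared: "(norm M)\<^sup>2 = (\<Sum>i\<in>UNIV. \<Sum>j\<in>UNIV. (M $ i $ j)\<^sup>2)"
  for M :: "real^'n^'m"
  by (simp add: norm_vec_def[of M] norm_vec_def[of "M $ _"] L2_set_def sum_nonneg)

text \<open>The norm of a matrix as a vector of vectors is its Frobenius norm.\<close>

lemma trace_gram: "trace (M ** transpose M) = (norm M)\<^sup>2" for M :: "real^'n^'n"
  unfolding norm_matrix_squared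
  by (simp add: trace_def matrix_matrix_mult_def transpose_def power2_eq_square)

lemma norm_matrix_squared_columns: "(norm M)\<^sup>2 = (\<Sum>j\<in>UNIV. (norm (M *v axis j 1))\<^sup>2)"
  for M :: "real^'n^'n"
proof -
  have "(norm M)\<^sup>2 = (\<Sum>j\<in>UNIV. \<Sum>i\<in>UNIV. (M $ i $ j)\<^sup>2)"
    unfolding norm_matrix_squared by (rule sum.swap)
  then show ?thesis
    by (simp add: matrix_vector_mult_basis column_def norm_vec_def L2_set_def sum_nonneg)
qed

lemma linear_trace: "linear (trace :: real^'n^'n \<Rightarrow> real)"
  by (rule linearI) (simp_all add: trace_def sum.distrib sum_distrib_left)

text \<open>A crude bound from the Leibniz expansion: all that is needed is that a small matrix has a small
determinant.\<close>

lemma abs_det_le: "\<bar>det R\<bar> \<le> fact CARD('n) * norm R ^ CARD('n)" for R :: "real^'n^'n"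
proof -
  have entry: "\<bar>R $ i $ j\<bar> \<le> norm R" for i j
    using component_le_norm_cart[of "R $ i" j] Finite_Cartesian_Product.norm_nth_le[of R i] by linarith
  have "\<bar>det R\<bar> \<le> (\<Sum>s\<in>{s. s permutes (UNIV :: 'n set)}. \<bar>of_int (sign s) * (\<Prod>i\<in>UNIV. R $ i $ s i)\<bar>)"
    unfolding det_def by (rule sum_abs)
  also have "\<dots> \<le> (\<Sum>s\<in>{s. s permutes (UNIV :: 'n set)}. norm R ^ CARD('n))"
  proof (rule sum_mono)
    fix s :: "'n \<Rightarrow> 'n"
    have "(\<Prod>i\<in>UNIV. \<bar>R $ i $ s i\<bar>) \<le> (\<Prod>i\<in>(UNIV :: 'n set). norm R)"
      by (rule prod_mono) (use entry in auto)
    then show "\<bar>of_int (sign s) * (\<Prod>i\<in>UNIV. R $ i $ s i)\<bar> \<le> norm R ^ CARD('n)"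
      by (simp add: abs_mult abs_prod sign_def)
  qed
  also have "\<dots> = fact CARD('n) * norm R ^ CARD('n)"
    using card_permutations[of "UNIV :: 'n set" "CARD('n)"] by simp
  finally show ?thesis .
qed

text \<open>If the factor \<open>q = (1 - p)\<^sup>M det(A)\<^sup>2\<close> were at least one, the second-moment matrices would keep determinant at
least one, although stability, applied to the coordinate vectors, makes their trace decay like
\<open>\<beta>\<^sup>t\<close>.\<close>

lemma mean_square_stable_imp_det_bound:
  fixes A F :: "real^'n^'n" and B :: "real^'m^'n" and C :: "real^'n^'m"
  assumes p: "0 \<le> p" "p < 1" and F: "F = A - B ** C" and \<beta>: "0 < \<beta>" "\<beta> < 1"
    and stable: "\<And>v t. bernoulli_mean p (Suc t) (\<lambda>b. (norm (transition A F b (Suc t) *v v))\<^sup>2)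
        \<le> L * \<beta> ^ t * (norm v)\<^sup>2"
  shows "(1 - p) ^ CARD('m) * (det A)\<^sup>2 < 1"
proof (rule ccontr)
  let ?q = "(1 - p) ^ CARD('m) * (det A)\<^sup>2"
  let ?N = "CARD('n)"
  assume "\<not> ?q < 1"
  then have q: "1 \<le> ?q" by simp
  then have "det A \<noteq> 0" by auto
  have bound: "1 \<le> (fact ?N)\<^sup>2 * (real ?N * L * \<beta> ^ t) ^ ?N" for t
  proof -
    obtain R where R: "R ** transpose R = second_moment p A F (Suc t)" "?q ^ Suc t \<le> (det R)\<^sup>2"
      using ex_gram_second_moment[OF \<open>det A \<noteq> 0\<close> p F] by blast
    have "(norm R)\<^sup>2 = bernoulli_mean p (Suc t) (\<lambda>b. (norm (transition A F b (Suc t)))\<^sup>2)"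
      unfolding trace_gram[symmetric] R(1) second_moment_def
      by (rule bernoulli_mean_linear[OF linear_trace])
    also have "\<dots> = (\<Sum>j\<in>(UNIV :: 'n set).
        bernoulli_mean p (Suc t) (\<lambda>b. (norm (transition A F b (Suc t) *v axis j 1))\<^sup>2))"
      unfolding norm_matrix_squared_columns by (rule bernoulli_mean_sum)
    also have "\<dots> \<le> (\<Sum>j\<in>(UNIV :: 'n set). L * \<beta> ^ t)"
      by (rule sum_mono) (use stable[of t "axis _ 1"] in simp)
    finally have "(norm R)\<^sup>2 \<le> real ?N * L * \<beta> ^ t" by simp
    then have "((norm R)\<^sup>2) ^ ?N \<le> (real ?N * L * \<beta> ^ t) ^ ?N"
      by (rule power_mono) simp
    then have moment: "(norm R ^ ?N)\<^sup>2 \<le> (real ?N * L * \<beta> ^ t) ^ ?N"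
      by (simp only: power_mult[symmetric] mult.commute)
    have "(det R)\<^sup>2 \<le> (fact ?N * norm R ^ ?N)\<^sup>2"
      using power_mono[OF abs_det_le[of R], of 2] by simp
    moreover have "1 \<le> ?q ^ Suc t"
      using q by (rule one_le_power)
    ultimately have "1 \<le> (fact ?N)\<^sup>2 * (norm R ^ ?N)\<^sup>2"
      using R(2) by (simp add: power_mult_distrib)
    also have "\<dots> \<le> (fact ?N)\<^sup>2 * (real ?N * L * \<beta> ^ t) ^ ?N"
      by (rule mult_left_mono[OF moment]) simp
    finally show ?thesis .
  qed
  have "(\<lambda>t. \<beta> ^ t) \<longlonglongrightarrow> 0"
    by (rule LIMSEQ_realpow_zero) (use \<beta> in auto)
  then have "(\<lambda>t. (fact ?N)\<^sup>2 * (real ?N * L * \<beta> ^ t) ^ ?N) \<longlonglongrightarrow> (fact ?N)\<^sup>2 * (real ?N * L * 0) ^ ?N"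
    by (rule tendsto_mult[OF tendsto_const tendsto_power[OF tendsto_mult[OF tendsto_const]]])
  then have "(\<lambda>t. (fact ?N)\<^sup>2 * (real ?N * L * \<beta> ^ t) ^ ?N) \<longlonglongrightarrow> 0"
    by (simp only: mult_zero_right zero_power[OF zero_less_card_finite])
  from LIMSEQ_le_const[OF this, of 1] bound show False by auto
qed

section \<open>Linearisation of the observer error\<close>

lemma observer_error_cong:
  assumes "\<And>k. k < t \<Longrightarrow> s k = s' k"
  shows "observer_error A C K s x0 e0 t = observer_error A C K s' x0 e0 t"
proof -
  have "observer_state A C K s x0 y t = observer_state A C K s' x0 y t" for y
    using assms by (induction t) auto
  then show ?thesis by (simp add: observer_error_def)
qed

lemma plant_state_0: "plant_state A 0 t = 0"
  by (induction t) auto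

lemma observer_error_0_0: "observer_error A C K s 0 0 t = 0"
proof -
  have "observer_state A C K s 0 0 t = 0"
    by (induction t) (auto simp: plant_state_0)
  then show ?thesis by (simp add: observer_error_def plant_state_0)
qed

lemma continuous_on_observer_error:
  fixes A :: "real^'n^'n" and C :: "real^'n^'m" and K :: "real^'m \<Rightarrow> real^'n"
  assumes "continuous_on UNIV K"
  shows "continuous_on UNIV (\<lambda>(x0, e0). observer_error A C K s x0 e0 t)"
proof -
  have K: "continuous_on UNIV (\<lambda>z. K (f z))" if "continuous_on UNIV f" for f :: "(real^'n) \<times> (real^'n) \<Rightarrow> real^'m"
    using continuous_on_compose2[OF assms that] by simp
  have M: "continuous_on UNIV (\<lambda>z. M *v f z)" if "continuous_on UNIV f"
    for M :: "real^'j^'k" and f :: "(real^'n) \<times> (real^'n) \<Rightarrow> real^'j"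
    using that by (intro bounded_linear.continuous_on[OF matrix_vector_mul_bounded_linear])
  have x: "continuous_on UNIV (\<lambda>z :: (real^'n) \<times> (real^'n). plant_state A (fst z) t)" for t
    by (induction t) (auto intro!: continuous_intros M)
  have "continuous_on UNIV (\<lambda>z. observer_state A C K s (fst z) (fst z - snd z) t)" for t
    by (induction t) (auto intro!: continuous_intros M K x)
  then show ?thesis
    unfolding observer_error_def case_prod_beta by (intro continuous_intros x)
qed

text \<open>With the plant at rest, the error obeys \<open>e\<^sub>t\<^sub>+\<^sub>1 = A e\<^sub>t - s\<^sub>t (K(0) - K(-C e\<^sub>t))\<close>. As \<open>0\<close>
is an equilibrium, the chain rule shows that the derivative follows the recursion linearised there.\<close>

lemma has_derivative_observer_error:
  fixes A :: "real^'n^'n" and C :: "real^'n^'m" and K :: "real^'m \<Rightarrow> real^'n"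
  assumes D: "(K has_derivative D) (at 0)"
  shows "((\<lambda>e0. observer_error A C K (indicator b) 0 e0 t) has_derivative
    (\<lambda>v. transition A (A - matrix D ** C) b t *v v)) (at 0)"
proof -
  let ?e = "\<lambda>t e0. observer_error A C K (indicator b) 0 e0 t"
  have lin: "linear D" using D by (rule has_derivative_linear)
  have M: "((\<lambda>z. M *v f z) has_derivative (\<lambda>v. M *v f' v)) (at 0)"
    if "(f has_derivative f') (at 0)" for M :: "real^'j^'k" and f and f' :: "real^'n \<Rightarrow> real^'j"
    using that by (rule bounded_linear.has_derivative[OF matrix_vector_mul_bounded_linear])
  show ?thesis
  proof (induction t)
    case 0
    then show ?case by (simp add: observer_error_def)
  next
    case (Suc t)
    let ?P = "transition A (A - matrix D ** C) b t"
    have neg: "M *v (- x) = - (M *v x)" for M :: "real^'n^'k" and x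
      using linear_neg[OF matrix_vector_mul_linear[of M], of x] by simp
    have Suc_eq: "?e (Suc t) = (\<lambda>e0. A *v ?e t e0
        - indicator b t *\<^sub>R K 0 + indicator b t *\<^sub>R K (C *v (- ?e t e0)))"
      by (auto simp: observer_error_def plant_state_0 neg)
    have inner: "((\<lambda>e0. C *v (- ?e t e0)) has_derivative (\<lambda>v. C *v (- (?P *v v)))) (at 0)"
      by (intro M has_derivative_minus Suc)
    have zero: "C *v (- ?e t 0) = 0" by (simp add: observer_error_0_0)
    have "((\<lambda>e0. K (C *v (- ?e t e0))) has_derivative (\<lambda>v. D (C *v (- (?P *v v))))) (at 0)"
      by (rule has_derivative_compose[OF inner]) (use D zero in simp)
    then have "(?e (Suc t) has_derivative (\<lambda>v. A *v (?P *v v) - 0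
         + indicator b t *\<^sub>R D (C *v (- (?P *v v))))) (at 0)"
      unfolding Suc_eq
      by (intro has_derivative_add has_derivative_diff has_derivative_const
          has_derivative_scaleR_right M Suc)
    moreover have "A *v (?P *v v) - 0 + indicator b t *\<^sub>R D (C *v (- (?P *v v)))
        = transition A (A - matrix D ** C) b (Suc t) *v v" for v
    proof -
      have "D x = matrix D *v x" for x
        using lin by simp
      moreover have "D (C *v (- (?P *v v))) = - D (C *v (?P *v v))"
        by (simp add: neg linear_neg[OF lin])
      ultimately show ?thesis
        by (auto simp: indicator_def matrix_vector_mult_diff_rdistrib
            simp flip: matrix_vector_mul_assoc)
    qed
    ultimately show ?case by simp
  qed
qed

lemma tendsto_scaled_difference_quotient:
  assumes D: "(f has_derivative f') (at 0)" and "f 0 = 0"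
  shows "((\<lambda>\<epsilon>. f (\<epsilon> *\<^sub>R v) /\<^sub>R \<epsilon>) \<longlongrightarrow> f' v) (at (0::real))"
proof -
  have "((\<lambda>\<epsilon>::real. \<epsilon> *\<^sub>R v) has_derivative (\<lambda>h. h *\<^sub>R v)) (at 0)"
    by (intro derivative_intros)
  from has_derivative_compose[OF this, of f f'] D
  have "((\<lambda>\<epsilon>::real. f (\<epsilon> *\<^sub>R v)) has_derivative (\<lambda>h. f' (h *\<^sub>R v))) (at 0)"
    by simp
  then have "((\<lambda>\<epsilon>. norm (f (\<epsilon> *\<^sub>R v) - f' (\<epsilon> *\<^sub>R v)) / norm \<epsilon>) \<longlongrightarrow> 0) (at 0)"
    using \<open>f 0 = 0\<close> by (simp add: has_derivative_iff_norm)
  moreover have "norm (f (\<epsilon> *\<^sub>R v) - f' (\<epsilon> *\<^sub>R v)) / norm \<epsilon> = norm (f (\<epsilon> *\<^sub>R v) /\<^sub>R \<epsilon> - f' v)"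
    if "\<epsilon> \<noteq> 0" for \<epsilon>
  proof -
    have "f (\<epsilon> *\<^sub>R v) - f' (\<epsilon> *\<^sub>R v) = \<epsilon> *\<^sub>R (f (\<epsilon> *\<^sub>R v) /\<^sub>R \<epsilon> - f' v)"
      using that linear_cmul[OF has_derivative_linear[OF D], of \<epsilon> v] by (simp add: algebra_simps)
    then show ?thesis using that by simp
  qed
  then have "eventually (\<lambda>\<epsilon>. norm (f (\<epsilon> *\<^sub>R v) - f' (\<epsilon> *\<^sub>R v)) / norm \<epsilon>
      = norm (f (\<epsilon> *\<^sub>R v) /\<^sub>R \<epsilon> - f' v)) (at 0)"
    by (auto simp: eventually_at_filter)
  ultimately have "((\<lambda>\<epsilon>. norm (f (\<epsilon> *\<^sub>R v) /\<^sub>R \<epsilon> - f' v)) \<longlongrightarrow> 0) (at 0)"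
    by (rule Lim_transform_eventually)
  then show ?thesis
    by (rule LIM_zero_cancel[OF tendsto_norm_zero_cancel])
qed

text \<open>A violation would hold on a nonempty open set, and such a set is not negligible.\<close>

lemma AE_le_imp_le_continuous:
  fixes f g :: "'a::euclidean_space \<Rightarrow> real"
  assumes "AE z in lebesgue. f z \<le> g z" "continuous_on UNIV f" "continuous_on UNIV g"
  shows "f z \<le> g z"
proof (rule ccontr)
  assume "\<not> f z \<le> g z"
  then have "z \<in> {z. g z < f z}" by simp
  moreover have op: "open {z. g z < f z}"
    by (rule open_Collect_less) (use assms in auto)
  moreover have "negligible {z. g z < f z}"
  proof -
    have "{z. \<not> f z \<le> g z} \<in> null_sets lebesgue"
      using assms(1) op by (subst (asm) AE_iff_null) (auto simp: not_le)
    then show ?thesis by (simp add: negligible_iff_null_sets not_le)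
  qed
  ultimately show False using open_not_negligible by blast
qed

text \<open>Both sides of the stability bound are continuous in the initial data, so it holds everywhere; the
slice \<open>x\<^sub>0 = 0\<close>, although itself a null set, can therefore be used. Homogeneity of degree two of the
right-hand side is what lets the bound survive division by \<open>\<epsilon>\<^sup>2\<close>.\<close>

lemma MSE_stable_imp_linearisation_stable:
  fixes A :: "real^'n^'n" and C :: "real^'n^'m" and K :: "real^'m \<Rightarrow> real^'n"
  assumes iid: "iid_bernoulli W \<xi> p" and cont: "continuous_on UNIV K"
    and D: "(K has_derivative D) (at 0)" and stable: "MSE_stable W \<xi> A C K"
  obtains L \<beta> where "0 < \<beta>" "\<beta> < 1"
    "\<And>v t. bernoulli_mean p (Suc t)
        (\<lambda>b. (norm (transition A (A - matrix D ** C) b (Suc t) *v v))\<^sup>2) \<le> L * \<beta> ^ t * (norm v)\<^sup>2"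
proof -
  from stable obtain L \<beta> where \<beta>: "0 < \<beta>" "\<beta> < 1" and
    ae: "AE (x0, e0) in lebesgue. \<forall>t. integral\<^sup>L W
        (\<lambda>\<omega>. (norm (observer_error A C K (\<lambda>k. \<xi> k \<omega>) x0 e0 (Suc t)))\<^sup>2) \<le> L * \<beta> ^ t * (norm e0)\<^sup>2"
    unfolding MSE_stable_def by blast
  define m where "m x0 e0 t = bernoulli_mean p t
    (\<lambda>b. (norm (observer_error A C K (indicator b) x0 e0 t))\<^sup>2)" for x0 e0 t
  have int: "integral\<^sup>L W (\<lambda>\<omega>. (norm (observer_error A C K (\<lambda>k. \<xi> k \<omega>) x0 e0 t))\<^sup>2) = m x0 e0 t"
    for x0 e0 t
  proof -
    have "observer_error A C K (\<lambda>k. \<xi> k \<omega>) x0 e0 t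
        = observer_error A C K (indicator {k. k < t \<and> \<xi> k \<omega> = 1}) x0 e0 t" if "\<omega> \<in> space W" for \<omega>
      by (rule observer_error_cong) (use iid that in \<open>auto simp: iid_bernoulli_def indicator_def\<close>)
    then have "integral\<^sup>L W (\<lambda>\<omega>. (norm (observer_error A C K (\<lambda>k. \<xi> k \<omega>) x0 e0 t))\<^sup>2)
      = integral\<^sup>L W (\<lambda>\<omega>. (norm (observer_error A C K (indicator {k. k < t \<and> \<xi> k \<omega> = 1}) x0 e0 t))\<^sup>2)"
      by (intro Bochner_Integration.integral_cong) auto
    then show ?thesis
      unfolding m_def by (simp add: expectation_eq_bernoulli_mean[OF iid,
          of "\<lambda>b. (norm (observer_error A C K (indicator b) x0 e0 t))\<^sup>2"])
  qed
  have everywhere: "m x0 e0 (Suc t) \<le> L * \<beta> ^ t * (norm e0)\<^sup>2" for x0 e0 t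
  proof -
    let ?f = "\<lambda>z. m (fst z) (snd z) (Suc t)" and ?g = "\<lambda>z :: (real^'n) \<times> (real^'n). L * \<beta> ^ t * (norm (snd z))\<^sup>2"
    have "AE z in lebesgue. ?f z \<le> ?g z"
      using ae by (simp add: int case_prod_beta) (erule eventually_mono, simp)
    moreover have "continuous_on UNIV ?f"
      unfolding m_def bernoulli_mean_def
      by (intro continuous_intros continuous_on_observer_error[OF cont, unfolded case_prod_beta])
    moreover have "continuous_on UNIV ?g"
      by (intro continuous_intros)
    ultimately have "?f (x0, e0) \<le> ?g (x0, e0)"
      by (rule AE_le_imp_le_continuous)
    then show ?thesis by simp
  qed
  show thesis
  proof (rule that[OF \<beta>])
    fix v t
    let ?e = "\<lambda>b e0. observer_error A C K (indicator b) 0 e0 (Suc t)"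
    let ?P = "\<lambda>b. transition A (A - matrix D ** C) b (Suc t)"
    have "((\<lambda>\<epsilon>. ?e b (\<epsilon> *\<^sub>R v) /\<^sub>R \<epsilon>) \<longlongrightarrow> ?P b *v v) (at (0::real))" for b
      by (rule tendsto_scaled_difference_quotient[OF has_derivative_observer_error[OF D]])
        (rule observer_error_0_0)
    then have lim: "((\<lambda>\<epsilon>. bernoulli_mean p (Suc t) (\<lambda>b. (norm (?e b (\<epsilon> *\<^sub>R v) /\<^sub>R \<epsilon>))\<^sup>2))
        \<longlongrightarrow> bernoulli_mean p (Suc t) (\<lambda>b. (norm (?P b *v v))\<^sup>2)) (at (0::real))"
      unfolding bernoulli_mean_def by (intro tendsto_intros)
    have "bernoulli_mean p (Suc t) (\<lambda>b. (norm (?e b (\<epsilon> *\<^sub>R v) /\<^sub>R \<epsilon>))\<^sup>2) \<le> L * \<beta> ^ t * (norm v)\<^sup>2"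
      if "\<epsilon> \<noteq> 0" for \<epsilon> :: real
    proof -
      have "bernoulli_mean p (Suc t) (\<lambda>b. (norm (?e b (\<epsilon> *\<^sub>R v) /\<^sub>R \<epsilon>))\<^sup>2)
          = m 0 (\<epsilon> *\<^sub>R v) (Suc t) / \<epsilon>\<^sup>2"
        unfolding m_def bernoulli_mean_def sum_divide_distrib
        by (intro sum.cong) (simp_all add: power_mult_distrib power_inverse divide_inverse)
      also have "\<dots> \<le> (L * \<beta> ^ t * (norm (\<epsilon> *\<^sub>R v))\<^sup>2) / \<epsilon>\<^sup>2"
        by (intro divide_right_mono everywhere) simp
      also have "\<dots> = L * \<beta> ^ t * (norm v)\<^sup>2"
        using that by (simp add: power_mult_distrib)
      finally show ?thesis .
    qed
    then have "eventually (\<lambda>\<epsilon>. bernoulli_mean p (Suc t) (\<lambda>b. (norm (?e b (\<epsilon> *\<^sub>R v) /\<^sub>R \<epsilon>))\<^sup>2)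
        \<le> L * \<beta> ^ t * (norm v)\<^sup>2) (at (0::real))"
      by (auto simp: eventually_at_filter)
    with lim show "bernoulli_mean p (Suc t) (\<lambda>b. (norm (?P b *v v))\<^sup>2) \<le> L * \<beta> ^ t * (norm v)\<^sup>2"
      by (rule tendsto_upperbound) simp
  qed
qed

section \<open>The determinant as a product of eigenvalues\<close>

lemma poly_charpoly: "poly (charpoly A) z
    = (det (\<chi> i j. (if i = j then z else 0) - complex_of_real (A $ i $ j)) :: complex)"
  unfolding charpoly_def det_def
  by (auto simp: poly_sum poly_prod intro!: sum.cong prod.cong)

lemma poly_charpoly_0: "cmod (poly (charpoly A) 0) = \<bar>det A\<bar>"
  for A :: "real^'n^'n"
proof -
  have "poly (charpoly A) 0 = (-1) ^ CARD('n) * complex_of_real (det A)"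
    by (simp add: poly_charpoly det_def prod_uminus sum_distrib_left mult.left_commute)
  then show ?thesis by (simp add: norm_mult norm_power)
qed

text \<open>The leading coefficient is the limit of \<open>det (z I - A) / z\<^sup>N = det (I - A / z)\<close> as \<open>z\<close> tends to
infinity. The hypothesis on the degree is available below because the \<open>N\<close> numbers \<open>lam k\<close> are
precisely the roots with multiplicity.\<close>

lemma lead_coeff_charpoly:
  fixes A :: "real^'n^'n"
  assumes "degree (charpoly A) = CARD('n)"
  shows "lead_coeff (charpoly A) = 1"
proof -
  let ?N = "\<lambda>z::complex. \<chi> i j. (if i = j then 1 else 0) - complex_of_real (A $ i $ j) / z"
  have "poly (charpoly A) z / z ^ CARD('n) = det (?N z)" if "z \<noteq> 0" for z
  proof -
    have "(\<Prod>i\<in>UNIV. (if i = s i then z else 0) - complex_of_real (A $ i $ s i))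
      = z ^ CARD('n) * (\<Prod>i\<in>UNIV. (if i = s i then 1 else 0) - complex_of_real (A $ i $ s i) / z)" for s
      using that by (subst prod_constant[symmetric], subst prod.distrib[symmetric])
        (intro prod.cong, auto simp: field_simps)
    then have "poly (charpoly A) z = z ^ CARD('n) * det (?N z)"
      by (simp add: poly_charpoly det_def sum_distrib_left mult.left_commute)
    with that show ?thesis by simp
  qed
  then have "eventually (\<lambda>z. poly (charpoly A) z / z ^ CARD('n) = det (?N z)) at_infinity"
    by (intro eventually_mono[OF eventually_not_equal_at_infinity[of 0]]) auto
  from _ this have "((\<lambda>z. det (?N z)) \<longlongrightarrow> lead_coeff (charpoly A)) at_infinity"
  proof (rule Lim_transform_eventually)
    show "((\<lambda>z. poly (charpoly A) z / z ^ CARD('n)) \<longlongrightarrow> lead_coeff (charpoly A)) at_infinity"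
    using poly_divide_tendsto_aux[of "charpoly A"] assms by simp
  qed
  moreover have "((\<lambda>z. det (?N z)) \<longlongrightarrow> det (mat 1 :: complex^'n^'n)) at_infinity"
  proof -
    have "((\<lambda>z. (if i = j then 1 else 0) - complex_of_real (A $ i $ j) / z)
       \<longlongrightarrow> (if i = j then 1 else 0) - 0) at_infinity" for i j
      by (intro tendsto_diff tendsto_const tendsto_divide_0[OF tendsto_const] filterlim_ident)
    then show ?thesis
      unfolding det_def mat_def by (simp, intro tendsto_intros) auto
  qed
  ultimately show ?thesis
    using tendsto_unique[OF trivial_limit_at_infinity] by fastforce
qed

lemma prod_cmod_eigenvalues:
  fixes A :: "real^'n^'n" and lam :: "nat \<Rightarrow> complex"
  assumes "image_mset lam (mset_set {1..CARD('n)}) = eigenvalues A"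
  shows "(\<Prod>k=1..CARD('n). cmod (lam k)) = \<bar>det A\<bar>"
proof -
  have "degree (charpoly A) = CARD('n)"
    using arg_cong[OF assms, of size]
    by (simp add: eigenvalues_def size_proots_complex)
  then have "charpoly A = (\<Prod>x\<in>#eigenvalues A. [:-x, 1:])"
    using complex_poly_decompose_multiset[of "charpoly A"] lead_coeff_charpoly[of A]
    by (simp add: eigenvalues_def)
  also have "\<dots> = (\<Prod>k=1..CARD('n). [:- lam k, 1:])"
    unfolding assms[symmetric] by (simp add: prod_unfold_prod_mset image_mset.compositionality o_def)
  finally have "cmod (poly (charpoly A) 0) = (\<Prod>k=1..CARD('n). cmod (lam k))"
    by (simp add: poly_prod flip: prod_norm)
  then show ?thesis by (simp add: poly_charpoly_0)
qed

section \<open>The necessary condition for mean square stability\<close>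

theorem theorem13:
  fixes A :: "real^'n^'n" and C :: "real^'n^'m" and K :: "real^'m \<Rightarrow> real^'n"
    and W :: "'w measure" and \<xi> :: "nat \<Rightarrow> 'w \<Rightarrow> real" and p :: real
    and r :: nat and lam :: "nat \<Rightarrow> complex"
  assumes "CARD('m) < CARD('n)"
    and "observable A C"
    and "0 < p" and "p < 1"
    and "iid_bernoulli W \<xi> p"
    and "r \<ge> 1" and "C_class r K" and "K 0 = 0"
    and "image_mset lam (mset_set {1..CARD('n)}) = eigenvalues A"
    and "\<forall>k\<in>{1..CARD('n)}. cmod (lam k) > 1"
    and "MSE_stable W \<xi> A C K"
  shows "(1 - p) ^ CARD('m) * (\<Prod>k=1..CARD('n). cmod (lam k))\<^sup>2 < 1"
proof -
  from \<open>r \<ge> 1\<close> obtain r' where "r = Suc r'"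
    by (cases r) auto
  with \<open>C_class r K\<close> have "C_class (Suc r') K" by simp
  then obtain D where D: "\<forall>x. (K has_derivative D x) (at x)"
    unfolding C_class.simps by (elim exE conjE)
  then have "continuous_on UNIV K"
    by (intro continuous_at_imp_continuous_on ballI) (blast intro: has_derivative_continuous)
  from \<open>iid_bernoulli W \<xi> p\<close> this spec[OF D, of 0] \<open>MSE_stable W \<xi> A C K\<close>
  have "(1 - p) ^ CARD('m) * (det A)\<^sup>2 < 1"
  proof (rule MSE_stable_imp_linearisation_stable)
    fix L \<beta>
    assume "0 < \<beta>" "\<beta> < 1" "\<And>v t. bernoulli_mean p (Suc t)
        (\<lambda>b. (norm (transition A (A - matrix (D 0) ** C) b (Suc t) *v v))\<^sup>2) \<le> L * \<beta> ^ t * (norm v)\<^sup>2"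
    with less_imp_le[OF \<open>0 < p\<close>] \<open>p < 1\<close> show ?thesis
      by (rule mean_square_stable_imp_det_bound[OF _ _ refl])
  qed
  then show ?thesis
    using prod_cmod_eigenvalues[OF \<open>image_mset lam (mset_set {1..CARD('n)}) = eigenvalues A\<close>]
    by simp
qed

end
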